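(* Let $d\ge1$ and $\alpha\in[0,d]$, and assume that the Borel probability measure $\mu$ on $\mathbb T^d=(\mathbb R/\mathbb Z)^d$ is upper $\alpha$-Ahlfors regular with some constant $M>0$. Then $\mu-1\in\dot H^{-\gamma}(\mathbb T^d)$ for every $\gamma$ such that $$\gamma>\frac{d-\alpha}{2}.$$ Moreover, $$\|\mu-1\|_{\dot H^{-\gamma}}^2\le C\,(M+1)$$ for a constant $C>0$ depending only on $d$ and $\gamma$.
   Context: Here $1$ denotes Lebesgue measure on $\mathbb T^d$. For $\gamma\in\mathbb R$ and a finite signed measure $\sigma$ on $\mathbb T^d$ with $\sigma(\mathbb T^d)=0$, $\|\sigma\|_{\dot H^{-\gamma}}^2=\sum_{k\in\mathbb Z^d\setminus\{0\}}|k|^{-2\gamma}|\widehat\sigma_k|^2$ with $\widehat\sigma_k=\int_{\mathbb T^d}e^{2\pi i k\cdot x}\,d\sigma(x)$, and $\sigma\in\dot H^{-\gamma}(\mathbb T^d)$ means this quantity is finite. A positive measure $\sigma$ on $\mathbb T^d$ is upper $\alpha$-Ahlfors regular with constant $M$ if $\sigma(B_r(x))\le Mr^\alpha$ for all $x\in\operatorname{supp}\sigma$ and all $r\in(0,1]$.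
   Formalization: The constant C may depend on α as well as on d and γ: a C depending only on d and γ is impossible (d=1, γ=1/2, α=1/log n, μ uniform on an arc of length 1/n: M ≤ 2e, but the norm is unbounded). *)

theory Defs
  imports "HOL-Probability.Probability"
begin

section \<open>The torus\<close>

quotient_type circle = real / "\<lambda>x y. x - y \<in> \<int>"
proof (rule equivpI)
  show "reflp (\<lambda>x y::real. x - y \<in> \<int>)" by (simp add: reflp_def)
  show "symp (\<lambda>x y::real. x - y \<in> \<int>)"
    by (metis (no_types, lifting) Ints_minus minus_diff_eq sympI)
  show "transp (\<lambda>x y::real. x - y \<in> \<int>)"
  proof (rule transpI)
    fix x y z :: real
    assume "x - y \<in> \<int>" "y - z \<in> \<int>"
    then have "(x - y) + (y - z) \<in> \<int>" by (rule Ints_add)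
    then show "x - z \<in> \<int>" by simp
  qed
qed

lift_definition circle_of :: "real \<Rightarrow> circle" is "\<lambda>t. t" .

lemma infdist_Ints_add: "n \<in> \<int> \<Longrightarrow> infdist (x + n) \<int> \<le> infdist (x::real) \<int>"
proof -
  assume n: "n \<in> \<int>"
  obtain m where m: "m \<in> \<int>" "infdist x \<int> = dist x m"
    using infdist_attains_inf[of "\<int>::real set" x] closed_Ints by (metis Ints_0 empty_iff)
  have "infdist (x + n) \<int> \<le> dist (x + n) (m + n)"
    using m n by (intro infdist_le) auto
  then show ?thesis using m by simp
qed

lemma infdist_Ints_cong: "x - y \<in> \<int> \<Longrightarrow> infdist (x::real) \<int> = infdist y \<int>"
  using infdist_Ints_add[of "x - y" y] infdist_Ints_add[of "y - x" x]
  by (smt (verit) Ints_minus)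

lemma infdist_Ints_uminus: "infdist (- x) \<int> = infdist (x::real) \<int>"
proof -
  have *: "infdist (- x) \<int> \<le> infdist (x::real) \<int>" for x
  proof -
    obtain m where m: "m \<in> \<int>" "infdist x \<int> = dist x m"
      using infdist_attains_inf[of "\<int>::real set" x] closed_Ints by (metis Ints_0 empty_iff)
    have "infdist (- x) \<int> \<le> dist (- x) (- m)"
      using m by (intro infdist_le) auto
    then show ?thesis using m by (simp add: dist_real_def)
  qed
  from *[of x] *[of "- x"] show ?thesis by simp
qed

lemma infdist_Ints_triangle: "infdist (x + y) \<int> \<le> infdist x \<int> + infdist (y::real) \<int>"
proof -
  obtain m where m: "m \<in> \<int>" "infdist x \<int> = dist x m"
    using infdist_attains_inf[of "\<int>::real set" x] closed_Ints by (metis Ints_0 empty_iff)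
  obtain n where n: "n \<in> \<int>" "infdist y \<int> = dist y n"
    using infdist_attains_inf[of "\<int>::real set" y] closed_Ints by (metis Ints_0 empty_iff)
  have "infdist (x + y) \<int> \<le> dist (x + y) (m + n)"
    using m n by (intro infdist_le) auto
  also have "\<dots> \<le> dist x m + dist y n" by (rule dist_triangle_add)
  finally show ?thesis using m n by simp
qed

text \<open>The quotient metric: the distance of two classes is the distance of the difference of
  representatives to the nearest integer.\<close>

instantiation circle :: metric_space
begin

lift_definition dist_circle :: "circle \<Rightarrow> circle \<Rightarrow> real" is "\<lambda>x y. infdist (x - y) \<int>"
proof -
  fix x x' y y' :: real
  assume "x - x' \<in> \<int>" "y - y' \<in> \<int>"
  then have "(x - x') - (y - y') \<in> \<int>" by (rule Ints_diff)
  then show "infdist (x - y) \<int> = infdist (x' - y') \<int>"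
    by (intro infdist_Ints_cong) (simp add: algebra_simps)
qed

definition uniformity_circle :: "(circle \<times> circle) filter"
  where "uniformity_circle = (INF e\<in>{0<..}. principal {(x, y). dist x y < e})"

definition open_circle :: "circle set \<Rightarrow> bool"
  where "open_circle U \<longleftrightarrow> (\<forall>x\<in>U. eventually (\<lambda>(x', y). x' = x \<longrightarrow> y \<in> U) uniformity)"

instance
proof
  show "uniformity = (INF e\<in>{0<..}. principal {(x::circle, y). dist x y < e})"
    by (rule uniformity_circle_def)
  show "open U \<longleftrightarrow> (\<forall>x\<in>U. eventually (\<lambda>(x', y). x' = x \<longrightarrow> y \<in> U) uniformity)"
    for U :: "circle set"
    by (rule open_circle_def)
  show "dist x y = 0 \<longleftrightarrow> x = y" for x y :: circle
  proof transfer
    fix x y :: real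
    show "infdist (x - y) \<int> = 0 \<longleftrightarrow> x - y \<in> \<int>"
      using in_closed_iff_infdist_zero[OF closed_Ints, of "x - y"] Ints_0 by blast
  qed
  show "dist x y \<le> dist x z + dist y z" for x y z :: circle
  proof transfer
    fix x y z :: real
    have "infdist (x - y) \<int> \<le> infdist (x - z) \<int> + infdist (z - y) \<int>"
      using infdist_Ints_triangle[of "x - z" "z - y"] by simp
    then show "infdist (x - y) \<int> \<le> infdist (x - z) \<int> + infdist (y - z) \<int>"
      using infdist_Ints_uminus[of "y - z"] by simp
  qed
qed

end

text \<open>The \<open>d\<close>-dimensional torus, \<open>d = CARD('n)\<close>.  The metric that \<^typ>\<open>circle ^ 'n\<close> inherits from
  \<^typ>\<open>circle\<close> is the \<open>\<ell>\<^sup>2\<close> product metric, which is the quotient metric of the Euclidean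
  metric on \<open>\<real>\<^sup>d\<close>.\<close>

type_synonym 'n torus = "circle ^ 'n"

definition torus_of :: "real ^ 'n::finite \<Rightarrow> 'n torus"
  where "torus_of x = (\<chi> i. circle_of (x $ i))"

lemma continuous_on_circle_of: "continuous_on UNIV circle_of"
proof -
  have "dist (circle_of x) (circle_of y) \<le> dist x y" for x y
  proof transfer
    fix x y :: real
    show "infdist (x - y) \<int> \<le> dist x y"
      using infdist_le[of "0::real" \<int> "x - y"] by (simp add: dist_real_def)
  qed
  then show ?thesis
    unfolding continuous_on_iff by (meson order_le_less_trans)
qed

lemma continuous_on_torus_of: "continuous_on UNIV (torus_of :: real ^ 'n::finite \<Rightarrow> 'n torus)"
  unfolding torus_of_def
  by (intro continuous_on_vec_lambda continuous_on_compose2[OF continuous_on_circle_of]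
        continuous_intros) auto

lemma torus_of_measurable [measurable]: "torus_of \<in> borel_measurable borel"
  by (rule borel_measurable_continuous_onI[OF continuous_on_torus_of])

definition torus_lebesgue :: "('n::finite torus) measure"
  where "torus_lebesgue = distr (restrict_space lborel (cbox 0 1)) borel torus_of"

lemma prob_space_torus_lebesgue: "prob_space (torus_lebesgue :: ('n::finite torus) measure)"
proof -
  have "prob_space (restrict_space lborel (cbox 0 (1 :: real ^ 'n)))"
  proof
    have "measure lborel (cbox 0 (1 :: real ^ 'n)) = 1"
      by (subst content_cbox_cart) (auto simp: interval_eq_empty_cart)
    moreover have "emeasure lborel (cbox 0 (1 :: real ^ 'n)) \<noteq> \<top>"
      using emeasure_lborel_cbox_finite[of 0 "1 :: real ^ 'n"] by (simp add: less_top[symmetric])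
    ultimately have "emeasure lborel (cbox 0 (1 :: real ^ 'n)) = 1"
      by (subst emeasure_eq_ennreal_measure) auto
    then show "emeasure (restrict_space lborel (cbox 0 (1 :: real ^ 'n)))
        (space (restrict_space lborel (cbox 0 1))) = 1"
      by (simp add: emeasure_restrict_space space_restrict_space)
  qed
  then show ?thesis
    unfolding torus_lebesgue_def
    by (rule prob_space.prob_space_distr) (auto intro: measurable_restrict_space1)
qed

lift_definition circle_char :: "int \<Rightarrow> circle \<Rightarrow> complex"
  is "\<lambda>m t. exp (2 * of_real pi * \<i> * of_int m * of_real t)"
proof -
  fix m :: int and x y :: real
  assume "x - y \<in> \<int>"
  then obtain n where n: "x = y + of_int n"
    by (metis Ints_cases add.commute diff_add_cancel)
  have "exp (2 * of_real pi * \<i> * of_int m * of_real x) =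
      exp (2 * of_real pi * \<i> * of_int m * of_real y) * exp (of_int (m * n) * (of_real (2 * pi) * \<i>))"
    by (simp add: n exp_add[symmetric] algebra_simps)
  also have "exp (of_int (m * n) * (complex_of_real (2 * pi) * \<i>)) = 1"
    by (simp add: exp_eq_1) (metis mult.commute mult.left_commute of_int_mult)
  finally show "exp (2 * of_real pi * \<i> * of_int m * of_real x) =
      exp (2 * of_real pi * \<i> * of_int m * complex_of_real y)"
    by simp
qed

text \<open>The character \<open>e\<^sup>2\<^sup>\<pi>\<^sup>i\<^sup>k\<^sup>\<cdot>\<^sup>x\<close>; see \<open>torus_char_torus_of\<close>.\<close>

definition torus_char :: "int ^ 'n::finite \<Rightarrow> 'n torus \<Rightarrow> complex"
  where "torus_char k x = (\<Prod>i\<in>UNIV. circle_char (k $ i) (x $ i))"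

lemma torus_char_torus_of:
  "torus_char k (torus_of x) =
    exp (2 * of_real pi * \<i> * of_real (\<Sum>i\<in>UNIV. of_int (k $ i) * x $ i))"
proof -
  have "circle_char (k $ i) (circle_of (x $ i)) =
      exp (2 * of_real pi * \<i> * of_int (k $ i) * of_real (x $ i))" for i
    by (transfer fixing: k x) simp
  then show ?thesis
    by (simp add: torus_char_def torus_of_def exp_sum[symmetric] sum_distrib_left mult.assoc)
qed

section \<open>Support and upper Ahlfors regularity\<close>

definition supp :: "'a::topological_space measure \<Rightarrow> 'a set"
  where "supp \<mu> = {x. \<forall>U. open U \<and> x \<in> U \<longrightarrow> emeasure \<mu> U > 0}"

definition upper_ahlfors_regular :: "real \<Rightarrow> real \<Rightarrow> 'a::metric_space measure \<Rightarrow> bool"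
  where "upper_ahlfors_regular \<alpha> M \<sigma> \<longleftrightarrow>
    (\<forall>x\<in>supp \<sigma>. \<forall>r\<in>{0<..1}. emeasure \<sigma> (ball x r) \<le> ennreal (M * r powr \<alpha>))"

section \<open>Finite signed measures\<close>

text \<open>A finite signed Borel measure is a real set function; only its values on Borel sets matter.\<close>

definition finite_signed_measure :: "('a::topological_space set \<Rightarrow> real) \<Rightarrow> bool"
  where "finite_signed_measure \<sigma> \<longleftrightarrow> \<sigma> {} = 0 \<and>
    (\<forall>A::nat \<Rightarrow> 'a set. range A \<subseteq> sets borel \<and> disjoint_family A \<longrightarrow>
      (\<lambda>i. \<sigma> (A i)) sums \<sigma> (\<Union>i. A i))"

definition signed_diff :: "'a measure \<Rightarrow> 'a measure \<Rightarrow> 'a set \<Rightarrow> real"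
  where "signed_diff \<mu> \<nu> A = measure \<mu> A - measure \<nu> A"

text \<open>The integral of a bounded Borel function against a finite signed measure: write the latter as
  a difference of finite positive measures (possible by the Jordan decomposition).  The value does
  not depend on the choice of the two measures; see \<open>signed_integral_signed_diff\<close>.\<close>

definition signed_integral :: "('a::topological_space set \<Rightarrow> real) \<Rightarrow> ('a \<Rightarrow> complex) \<Rightarrow> complex"
  where "signed_integral \<sigma> f = (THE z. \<exists>\<mu> \<nu>. finite_measure \<mu> \<and> finite_measure \<nu> \<and>
    sets \<mu> = sets borel \<and> sets \<nu> = sets borel \<and>
    (\<forall>A\<in>sets borel. \<sigma> A = signed_diff \<mu> \<nu> A) \<and>
    z = integral\<^sup>L \<mu> f - integral\<^sup>L \<nu> f)"

lemma finite_signed_measure_signed_diff: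
  fixes \<mu> \<nu> :: "'a::topological_space measure"
  assumes "finite_measure \<mu>" "finite_measure \<nu>" "sets \<mu> = sets borel" "sets \<nu> = sets borel"
  shows "finite_signed_measure (signed_diff \<mu> \<nu>)"
  unfolding finite_signed_measure_def signed_diff_def
  using assms finite_measure.finite_measure_UNION[of \<mu>] finite_measure.finite_measure_UNION[of \<nu>]
  by (auto intro!: sums_diff)

lemma nn_integral_add_measures_cong:
  assumes sets: "sets \<mu>1 = sets M" "sets \<mu>2 = sets M" "sets \<nu>1 = sets M" "sets \<nu>2 = sets M"
    and eq: "\<And>A. A \<in> sets M \<Longrightarrow>
      emeasure \<mu>1 A + emeasure \<nu>2 A = emeasure \<mu>2 A + emeasure \<nu>1 A"
    and f: "f \<in> borel_measurable M"
  shows "(\<integral>\<^sup>+x. f x \<partial>\<mu>1) + (\<integral>\<^sup>+x. f x \<partial>\<nu>2) = (\<integral>\<^sup>+x. f x \<partial>\<mu>2) + (\<integral>\<^sup>+x. f x \<partial>\<nu>1)"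
  using f
proof (induction rule: borel_measurable_induct)
  note meas = measurable_cong_sets[OF sets(1) refl] measurable_cong_sets[OF sets(2) refl]
    measurable_cong_sets[OF sets(3) refl] measurable_cong_sets[OF sets(4) refl]
  note sp = sets_eq_imp_space_eq[OF sets(1)] sets_eq_imp_space_eq[OF sets(2)]
    sets_eq_imp_space_eq[OF sets(3)] sets_eq_imp_space_eq[OF sets(4)]
  {
    case (cong f g)
    then have "(\<integral>\<^sup>+x. f x \<partial>N) = (\<integral>\<^sup>+x. g x \<partial>N)" if "sets N = sets M" for N
      using sets_eq_imp_space_eq[OF that] by (intro nn_integral_cong) auto
    then show ?case using cong sets by metis
  next
    case (set A)
    then show ?case using eq sets by simp
  next
    case (mult u c)
    then show ?case by (simp add: nn_integral_cmult meas distrib_left[symmetric])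
  next
    case (add u v)
    then show ?case by (simp add: nn_integral_add meas) (metis add.assoc add.left_commute)
  next
    case (seq U)
    have *: "(\<integral>\<^sup>+x. (SUP i. U i) x \<partial>N1) + (\<integral>\<^sup>+x. (SUP i. U i) x \<partial>N2) =
        (SUP i. (\<integral>\<^sup>+x. U i x \<partial>N1) + (\<integral>\<^sup>+x. U i x \<partial>N2))"
      if "sets N1 = sets M" "sets N2 = sets M" for N1 N2
    proof -
      have m: "U i \<in> borel_measurable N1" "U i \<in> borel_measurable N2" for i
        using seq(1) that by (auto simp: measurable_cong_sets[OF that(1) refl]
            measurable_cong_sets[OF that(2) refl])
      have "incseq (\<lambda>i. \<integral>\<^sup>+x. U i x \<partial>N)" for N :: "'a measure"
        using seq(3) by (auto simp: incseq_def le_fun_def intro!: nn_integral_mono)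
      then show ?thesis
        using m seq(3)
        by (simp add: SUP_apply image_comp nn_integral_monotone_convergence_SUP ennreal_SUP_add)
    qed
    show ?case using seq.IH by (simp only: *[OF sets(1,4)] *[OF sets(2,3)])
  }
qed

lemma integral_signed_diff_cong:
  fixes f :: "'a::topological_space \<Rightarrow> complex"
  assumes fin: "finite_measure \<mu>1" "finite_measure \<mu>2" "finite_measure \<nu>1" "finite_measure \<nu>2"
    and sets: "sets \<mu>1 = sets borel" "sets \<mu>2 = sets borel" "sets \<nu>1 = sets borel" "sets \<nu>2 = sets borel"
    and eq: "\<And>A. A \<in> sets borel \<Longrightarrow> signed_diff \<mu>1 \<nu>1 A = signed_diff \<mu>2 \<nu>2 A"
    and f: "f \<in> borel_measurable borel" and bd: "\<And>x. norm (f x) \<le> B"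
  shows "integral\<^sup>L \<mu>1 f - integral\<^sup>L \<nu>1 f = integral\<^sup>L \<mu>2 f - integral\<^sup>L \<nu>2 f"
proof -
  have eq': "emeasure \<mu>1 A + emeasure \<nu>2 A = emeasure \<mu>2 A + emeasure \<nu>1 A" if "A \<in> sets borel" for A
    using eq[OF that]
    by (simp add: signed_diff_def finite_measure.emeasure_eq_measure[OF fin(1)]
        finite_measure.emeasure_eq_measure[OF fin(2)] finite_measure.emeasure_eq_measure[OF fin(3)]
        finite_measure.emeasure_eq_measure[OF fin(4)] ennreal_plus[symmetric] del: ennreal_plus)
  have real: "integral\<^sup>L \<mu>1 g + integral\<^sup>L \<nu>2 g = integral\<^sup>L \<mu>2 g + integral\<^sup>L \<nu>1 g"
    if g: "g \<in> borel_measurable borel" "\<And>x. \<bar>g x\<bar> \<le> B" for g :: "'a \<Rightarrow> real"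
  proof -
    have split: "integrable N (\<lambda>x. max 0 (h x)) \<and>
        (\<integral>\<^sup>+x. ennreal (max 0 (h x)) \<partial>N) = ennreal (integral\<^sup>L N (\<lambda>x. max 0 (h x)))"
      if "finite_measure N" "sets N = sets borel" "h \<in> borel_measurable borel" "\<And>x. \<bar>h x\<bar> \<le> B"
      for N and h :: "'a \<Rightarrow> real"
    proof -
      have "B \<ge> 0" using that(4)[of undefined] by linarith
      have [measurable]: "h \<in> borel_measurable N"
        using that(3) by (simp add: measurable_cong_sets[OF that(2) refl])
      have i: "integrable N (\<lambda>x. max 0 (h x))"
      proof (rule finite_measure.integrable_const_bound[OF that(1), where B = B])
        show "AE x in N. norm (max 0 (h x)) \<le> B"
          using that(4) \<open>B \<ge> 0\<close> by (intro AE_I2) (smt (verit) real_norm_def)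
      qed measurable
      then show ?thesis
        using nn_integral_eq_integral[OF i] by simp
    qed
    have pos: "integral\<^sup>L \<mu>1 (\<lambda>x. max 0 (h x)) + integral\<^sup>L \<nu>2 (\<lambda>x. max 0 (h x)) =
        integral\<^sup>L \<mu>2 (\<lambda>x. max 0 (h x)) + integral\<^sup>L \<nu>1 (\<lambda>x. max 0 (h x))"
      if h: "h \<in> borel_measurable borel" "\<And>x. \<bar>h x\<bar> \<le> B" for h :: "'a \<Rightarrow> real"
    proof -
      have [measurable]: "h \<in> borel_measurable borel" by (rule h)
      have "(\<integral>\<^sup>+x. ennreal (max 0 (h x)) \<partial>\<mu>1) + (\<integral>\<^sup>+x. ennreal (max 0 (h x)) \<partial>\<nu>2) =
          (\<integral>\<^sup>+x. ennreal (max 0 (h x)) \<partial>\<mu>2) + (\<integral>\<^sup>+x. ennreal (max 0 (h x)) \<partial>\<nu>1)"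
        by (rule nn_integral_add_measures_cong[OF sets eq']) auto
      then show ?thesis
        using split[OF fin(1) sets(1) h] split[OF fin(2) sets(2) h] split[OF fin(3) sets(3) h]
          split[OF fin(4) sets(4) h]
        by (simp add: ennreal_plus[symmetric] add_nonneg_nonneg del: ennreal_plus)
    qed
    have dec: "integral\<^sup>L N g = integral\<^sup>L N (\<lambda>x. max 0 (g x)) - integral\<^sup>L N (\<lambda>x. max 0 (- g x))"
      if "finite_measure N" "sets N = sets borel" for N
    proof -
      have "integral\<^sup>L N g = integral\<^sup>L N (\<lambda>x. max 0 (g x) - max 0 (- g x))"
        by (intro Bochner_Integration.integral_cong) auto
      also have "\<dots> = integral\<^sup>L N (\<lambda>x. max 0 (g x)) - integral\<^sup>L N (\<lambda>x. max 0 (- g x))"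
        using split[OF that g] split[OF that, of "\<lambda>x. - g x"] g
        by (intro Bochner_Integration.integral_diff) auto
      finally show ?thesis .
    qed
    show ?thesis
      using pos[OF g] pos[of "\<lambda>x. - g x"] g dec[OF fin(1) sets(1)] dec[OF fin(2) sets(2)]
        dec[OF fin(3) sets(3)] dec[OF fin(4) sets(4)] by simp
  qed
  have int: "integrable N f" if "finite_measure N" "sets N = sets borel" for N
  proof (rule finite_measure.integrable_const_bound[OF that(1), where B = B])
    show "f \<in> borel_measurable N" using f by (simp add: measurable_cong_sets[OF that(2) refl])
  qed (use bd in auto)
  have re: "integral\<^sup>L \<mu>1 (\<lambda>x. Re (f x)) + integral\<^sup>L \<nu>2 (\<lambda>x. Re (f x)) =
      integral\<^sup>L \<mu>2 (\<lambda>x. Re (f x)) + integral\<^sup>L \<nu>1 (\<lambda>x. Re (f x))"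
    using f bd abs_Re_le_cmod by (intro real) (auto intro: order_trans)
  have im: "integral\<^sup>L \<mu>1 (\<lambda>x. Im (f x)) + integral\<^sup>L \<nu>2 (\<lambda>x. Im (f x)) =
      integral\<^sup>L \<mu>2 (\<lambda>x. Im (f x)) + integral\<^sup>L \<nu>1 (\<lambda>x. Im (f x))"
    using f bd abs_Im_le_cmod by (intro real) (auto intro: order_trans)
  show ?thesis
    using re im int[OF fin(1) sets(1)] int[OF fin(2) sets(2)] int[OF fin(3) sets(3)]
      int[OF fin(4) sets(4)]
    by (simp add: complex_eq_iff)
qed

lemma signed_integral_signed_diff:
  fixes f :: "'a::topological_space \<Rightarrow> complex"
  assumes "finite_measure \<mu>" "finite_measure \<nu>" "sets \<mu> = sets borel" "sets \<nu> = sets borel"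
    and "f \<in> borel_measurable borel" "\<And>x. norm (f x) \<le> B"
  shows "signed_integral (signed_diff \<mu> \<nu>) f = integral\<^sup>L \<mu> f - integral\<^sup>L \<nu> f"
  unfolding signed_integral_def
proof (rule the_equality)
  show "\<exists>\<mu>' \<nu>'. finite_measure \<mu>' \<and> finite_measure \<nu>' \<and> sets \<mu>' = sets borel \<and>
      sets \<nu>' = sets borel \<and> (\<forall>A\<in>sets borel. signed_diff \<mu> \<nu> A = signed_diff \<mu>' \<nu>' A) \<and>
      integral\<^sup>L \<mu> f - integral\<^sup>L \<nu> f = integral\<^sup>L \<mu>' f - integral\<^sup>L \<nu>' f"
    using assms by blast
next
  fix z
  assume "\<exists>\<mu>' \<nu>'. finite_measure \<mu>' \<and> finite_measure \<nu>' \<and> sets \<mu>' = sets borel \<and>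
      sets \<nu>' = sets borel \<and> (\<forall>A\<in>sets borel. signed_diff \<mu> \<nu> A = signed_diff \<mu>' \<nu>' A) \<and>
      z = integral\<^sup>L \<mu>' f - integral\<^sup>L \<nu>' f"
  then obtain \<mu>' \<nu>' where *: "finite_measure \<mu>'" "finite_measure \<nu>'" "sets \<mu>' = sets borel"
    "sets \<nu>' = sets borel" "\<forall>A\<in>sets borel. signed_diff \<mu> \<nu> A = signed_diff \<mu>' \<nu>' A"
    "z = integral\<^sup>L \<mu>' f - integral\<^sup>L \<nu>' f"
    by blast
  show "z = integral\<^sup>L \<mu> f - integral\<^sup>L \<nu> f"
    unfolding *(6)
    by (rule integral_signed_diff_cong[OF *(1) assms(1) *(2) assms(2) *(3) assms(3) *(4) assms(4)
          _ assms(5,6)]) (use *(5) in auto)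
qed

section \<open>Homogeneous Sobolev norms\<close>

definition fourier_coeff :: "(('n::finite torus) set \<Rightarrow> real) \<Rightarrow> int ^ 'n::finite \<Rightarrow> complex"
  where "fourier_coeff \<sigma> k = signed_integral \<sigma> (torus_char k)"

definition freq_norm :: "int ^ 'n::finite \<Rightarrow> real"
  where "freq_norm k = norm (\<chi> i. real_of_int (k $ i))"

text \<open>The square of the norm of exponent \<open>s\<close> (so \<open>s = - \<gamma>\<close> for \<open>H\<^sup>-\<^sup>\<gamma>\<close>), as an extended
  nonnegative real: it is \<open>\<infinity>\<close> when the series diverges.\<close>

definition hdot_norm_sq :: "real \<Rightarrow> (('n::finite torus) set \<Rightarrow> real) \<Rightarrow> ennreal"
  where "hdot_norm_sq s \<sigma> =
    (\<Sum>\<^sub>\<infinity>k\<in>-{0}. ennreal (freq_norm k powr (2 * s) * (norm (fourier_coeff \<sigma> k))\<^sup>2))"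

definition hdot :: "real \<Rightarrow> (('n::finite torus) set \<Rightarrow> real) set"
  where "hdot s = {\<sigma>. finite_signed_measure \<sigma> \<and> \<sigma> UNIV = 0 \<and> hdot_norm_sq s \<sigma> < \<infinity>}"

end

theory Submission
  imports Defs
begin

text \<open>For a radius \<open>r\<close> let \<open>g(q)\<close> be the \<open>\<mu>\<close>-measure of the ball of radius \<open>r\<close> around \<open>q\<close>, the
  convolution of \<open>\<mu>\<close> with the indicator of a ball, and let \<open>b\<close> be the Lebesgue measure of that ball.
  The Fourier coefficient of \<open>g\<close> at \<open>k\<close> is that of \<open>\<mu>\<close> times that of the indicator, and the latter has
  modulus at least \<open>b / 2\<close> as long as \<open>4 \<pi> |k| r \<le> 1\<close>.  Bessel's inequality and
  \<open>\<integral>g\<^sup>2 \<le> sup g \<cdot> \<integral>g = b sup g\<close> then bound the sum of the squared coefficients of \<open>\<mu>\<close> over these \<open>k\<close>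
  by \<open>4 sup g / b\<close>, which is of order \<open>M r powr (\<alpha> - d)\<close> by Ahlfors regularity.  With \<open>r\<close> of order
  \<open>1 / 2 ^ j\<close> on the dyadic shell \<open>2 ^ j \<le> |k| < 2 ^ (j + 1)\<close>, the shell contributes at most a constant
  times \<open>M 2 powr (j (d - \<alpha> - 2 \<gamma>))\<close>, the term of a convergent geometric series.\<close>

section \<open>Geometry and Lebesgue measure of the torus\<close>

text \<open>Since \<open>\<int>\<close> is closed, some integer \<open>m\<close> attains the
  distance from \<open>s - p\<close> to \<open>\<int>\<close>; shifting a representative of
  \<open>p\<close> by \<open>m\<close> gives the lift.\<close>

lemma circle_of_nearest_lift: "\<exists>t. circle_of t = p \<and> dist s t = dist (circle_of s) p"
proof (transfer fixing: s)
  fix p :: real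
  obtain m where m: "m \<in> \<int>" "infdist (s - p) \<int> = dist (s - p) m"
    using infdist_attains_inf[of "\<int>::real set" "s - p"] closed_Ints by (metis Ints_0 empty_iff)
  then show "\<exists>t. t - p \<in> \<int> \<and> dist s t = infdist (s - p) \<int>"
    by (intro exI[of _ "p + m"]) (auto simp: dist_real_def algebra_simps)
qed

text \<open>Both metrics are the same \<open>\<ell>\<^sup>2\<close> combination of coordinate
  distances, so nearest lifts can be chosen coordinate by coordinate. Euclidean estimates thereby
  pass to the torus without loss.\<close>

lemma torus_of_nearest_lift:
  fixes x :: "real ^ 'n::finite"
  shows "\<exists>y. torus_of y = p \<and> dist x y = dist (torus_of x) p"
proof -
  have "\<forall>i. \<exists>t. circle_of t = p $ i \<and> dist (x $ i) t = dist (circle_of (x $ i)) (p $ i)"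
    using circle_of_nearest_lift by blast
  then obtain t where t: "\<And>i. circle_of (t i) = p $ i"
      "\<And>i. dist (x $ i) (t i) = dist (circle_of (x $ i)) (p $ i)"
    by metis
  show ?thesis
    by (rule exI[of _ "\<chi> i. t i"]) (simp add: torus_of_def vec_eq_iff dist_vec_def t)
qed

lemma surj_torus_of: "surj torus_of"
  unfolding surj_def using torus_of_nearest_lift by (metis (no_types))

lemma dist_torus_of_le: "dist (torus_of x) (torus_of y) \<le> dist x y"
proof -
  have "dist (circle_of s) (circle_of t) \<le> dist s t" for s t
    by transfer (use infdist_le[of "0::real" \<int>] in \<open>simp add: dist_real_def\<close>)
  then show ?thesis
    by (auto simp: dist_vec_def torus_of_def intro!: L2_set_mono)
qed

lemma dist_torus_of_translate: "dist (torus_of (x + a)) (torus_of (y + a)) = dist (torus_of x) (torus_of y)"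
proof -
  have "dist (circle_of (s + c)) (circle_of (t + c)) = dist (circle_of s) (circle_of t)" for s t c
    by transfer simp
  then show ?thesis
    by (simp add: dist_vec_def torus_of_def)
qed

section \<open>Lattice translations and the unit cell\<close>

definition of_int_vec :: "int ^ 'n::finite \<Rightarrow> real ^ 'n"
  where "of_int_vec n = (\<chi> i. of_int (n $ i))"

lemma circle_of_add_of_int: "circle_of (t + of_int m) = circle_of t"
  by transfer simp

lemma torus_of_add_of_int_vec: "torus_of (x + of_int_vec n) = torus_of x"
  by (simp add: torus_of_def of_int_vec_def circle_of_add_of_int)

text \<open>The cube is half-open so that it meets every orbit of the integer lattice exactly once;
  the closed cube in \<open>torus_lebesgue\<close> meets boundary orbits repeatedly.\<close>

definition unit_cell :: "(real ^ 'n::finite) set"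
  where "unit_cell = {x. \<forall>i. 0 \<le> x $ i \<and> x $ i < 1}"

lemma unit_cell_measurable [measurable]: "unit_cell \<in> sets borel"
  unfolding unit_cell_def by measurable

lemma unit_cell_fundamental: "\<exists>!n. x + of_int_vec n \<in> unit_cell"
proof (rule ex1I)
  show "x + of_int_vec (\<chi> i. - \<lfloor>x $ i\<rfloor>) \<in> unit_cell"
    by (simp add: unit_cell_def of_int_vec_def) linarith
  show "n = (\<chi> i. - \<lfloor>x $ i\<rfloor>)" if "x + of_int_vec n \<in> unit_cell" for n
    unfolding vec_eq_iff
  proof
    fix i
    have "0 \<le> x $ i + of_int (n $ i)" "x $ i + of_int (n $ i) < 1"
      using that by (auto simp: unit_cell_def of_int_vec_def)
    then show "n $ i = (\<chi> i. - \<lfloor>x $ i\<rfloor>) $ i" by simp linarith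
  qed
qed

lemma surj_on_unit_cell: "torus_of ` unit_cell = (UNIV :: ('n::finite torus) set)"
proof -
  have "p \<in> torus_of ` unit_cell" for p :: "'n torus"
    using surj_torus_of unit_cell_fundamental torus_of_add_of_int_vec by (metis image_eqI surjD)
  then show ?thesis by blast
qed

text \<open>The torus is the continuous image of a closed cube. This makes its closed balls compact,
  as the covering argument near the support requires.\<close>

lemma compact_torus: "compact (UNIV :: ('n::finite torus) set)"
proof -
  have "unit_cell \<subseteq> cbox (0 :: real ^ 'n) 1"
    by (auto simp: unit_cell_def mem_box_cart less_imp_le)
  then have "torus_of ` cbox (0 :: real ^ 'n) 1 = UNIV"
    using surj_on_unit_cell by blast
  then show ?thesis
    by (metis compact_cbox compact_continuous_image continuous_on_subset continuous_on_torus_of subset_UNIV)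
qed

section \<open>Translation invariance of Lebesgue measure on the torus\<close>

lemma emeasure_lborel_translate:
  assumes [measurable]: "A \<in> sets borel"
  shows "emeasure lborel {x. x + a \<in> A} = emeasure lborel (A :: 'a::euclidean_space set)"
proof -
  have "emeasure lborel A = emeasure (distr lborel borel (\<lambda>x. a + 1 *\<^sub>R x)) A"
    by (subst lborel_affine[of 1 a]) (auto simp: density_1)
  also have "\<dots> = emeasure lborel {x. x + a \<in> A}"
    by (subst emeasure_distr) (auto simp: vimage_def add.commute)
  finally show ?thesis by simp
qed

text \<open>Cut \<open>S \<inter> P\<close> into countably many pieces according to the unique
  lattice vector \<open>n\<close> that carries a point into \<open>Q\<close>. Translating each piece
  by its \<open>n\<close> preserves its measure and, by periodicity, membership in \<open>S\<close>;
  the translated pieces partition \<open>S \<inter> Q\<close>.\<close>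

lemma emeasure_fundamental_domains:
  fixes S P Q :: "(real ^ 'n::finite) set"
  assumes [measurable]: "S \<in> sets borel" "P \<in> sets borel" "Q \<in> sets borel"
    and periodic: "\<And>x n. x + of_int_vec n \<in> S \<longleftrightarrow> x \<in> S"
    and P: "\<And>x. \<exists>!n. x + of_int_vec n \<in> P"
    and Q: "\<And>x. \<exists>!n. x + of_int_vec n \<in> Q"
  shows "emeasure lborel (S \<inter> P) = emeasure lborel (S \<inter> Q)"
proof -
  \<comment> \<open>Seen from \<open>Q\<close>, the pieces are indexed by the vector that leads back
    to \<open>P\<close>, hence the change of sign.\<close>
  have P': "\<exists>!n. x - of_int_vec n \<in> P" for x
  proof -
    have "x - of_int_vec n = x + of_int_vec (- n)" for n
      by (simp add: of_int_vec_def vec_eq_iff)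
    then show ?thesis using P[of x] by (metis minus_minus)
  qed
  have "emeasure lborel (S \<inter> P) = emeasure lborel (\<Union>n. {x \<in> S \<inter> P. x + of_int_vec n \<in> Q})"
    using Q by (intro arg_cong[of _ _ "emeasure lborel"]) blast
  also have "\<dots> = (\<integral>\<^sup>+n. emeasure lborel {x \<in> S \<inter> P. x + of_int_vec n \<in> Q} \<partial>count_space UNIV)"
    using Q by (intro emeasure_UN_countable) (auto simp: disjoint_family_on_def)
  also have "\<dots> = (\<integral>\<^sup>+n. emeasure lborel {x \<in> S \<inter> Q. x - of_int_vec n \<in> P} \<partial>count_space UNIV)"
  proof (rule nn_integral_cong)
    fix n :: "int ^ 'n"
    define T where "T = {x \<in> S \<inter> Q. x - of_int_vec n \<in> P}"
    have "{x. x + of_int_vec n \<in> T} = {x \<in> S \<inter> P. x + of_int_vec n \<in> Q}"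
      using periodic by (auto simp: T_def)
    moreover have "T \<in> sets borel" unfolding T_def by measurable
    ultimately show "emeasure lborel {x \<in> S \<inter> P. x + of_int_vec n \<in> Q} =
        emeasure lborel {x \<in> S \<inter> Q. x - of_int_vec n \<in> P}"
      using emeasure_lborel_translate[of T "of_int_vec n"] by (simp only: T_def)
  qed
  also have "\<dots> = emeasure lborel (\<Union>n. {x \<in> S \<inter> Q. x - of_int_vec n \<in> P})"
    using P' by (intro emeasure_UN_countable[symmetric]) (auto simp: disjoint_family_on_def)
  also have "\<dots> = emeasure lborel (S \<inter> Q)"
    using P' by (intro arg_cong[of _ _ "emeasure lborel"]) blast
  finally show ?thesis .
qed

text \<open>The half-open cube lies between the open and the closed cube, whose difference is a null
  set.\<close>

lemma emeasure_cbox_unit_cell: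
  fixes S :: "(real ^ 'n::finite) set"
  assumes [measurable]: "S \<in> sets borel"
  shows "emeasure lborel (S \<inter> cbox 0 1) = emeasure lborel (S \<inter> unit_cell)"
proof -
  have sub: "box (0::real ^ 'n) 1 \<subseteq> unit_cell" "unit_cell \<subseteq> cbox (0::real ^ 'n) 1"
    by (auto simp: unit_cell_def mem_box_cart less_imp_le)
  have "emeasure lborel (cbox 0 (1::real ^ 'n) - box 0 1) = 0"
    by (subst emeasure_Diff)
      (auto simp: box_subset_cbox emeasure_lborel_cbox_eq emeasure_lborel_box_eq
        emeasure_lborel_box_finite)
  then have null: "cbox 0 (1::real ^ 'n) - box 0 1 \<in> null_sets lborel" by auto
  show ?thesis
  proof (rule emeasure_eq_AE)
    show "AE x in lborel. x \<in> S \<inter> cbox 0 1 \<longleftrightarrow> x \<in> S \<inter> unit_cell"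
      using AE_not_in[OF null] by eventually_elim (use sub in blast)
  qed auto
qed

text \<open>Pulled back to \<open>real ^ 'n\<close>, the set \<open>A\<close> becomes periodic, and
  translating by \<open>a\<close> merely replaces the unit cell by its translate, which is again a
  fundamental domain.\<close>

lemma torus_lebesgue_translate:
  fixes a :: "real ^ 'n::finite"
  shows "distr (restrict_space lborel (cbox 0 1)) borel (\<lambda>x. torus_of (x + a)) = torus_lebesgue"
proof (rule measure_eqI)
  fix A :: "'n torus set"
  assume "A \<in> sets (distr (restrict_space lborel (cbox 0 1)) borel (\<lambda>x. torus_of (x + a)))"
  then have [measurable]: "A \<in> sets borel" by simp
  have shift: "emeasure (distr (restrict_space lborel (cbox 0 1)) borel (\<lambda>x. torus_of (x + b))) A =
      emeasure lborel ({x. torus_of (x + b) \<in> A} \<inter> unit_cell)" for b :: "real ^ 'n"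
  proof -
    have "emeasure (distr (restrict_space lborel (cbox 0 1)) borel (\<lambda>x. torus_of (x + b))) A =
        emeasure lborel ({x. torus_of (x + b) \<in> A} \<inter> cbox 0 1)"
      by (subst emeasure_distr)
        (auto simp: space_restrict_space vimage_def Int_def
          intro!: measurable_restrict_space1 emeasure_restrict_space)
    then show ?thesis by (simp add: emeasure_cbox_unit_cell)
  qed
  define S where "S = {x. torus_of x \<in> A}"
  have [measurable]: "S \<in> sets borel" unfolding S_def by measurable
  have "emeasure lborel ({x. torus_of (x + a) \<in> A} \<inter> unit_cell) =
      emeasure lborel {x. x + a \<in> S \<inter> {x. x - a \<in> unit_cell}}"
    by (intro arg_cong[of _ _ "emeasure lborel"]) (auto simp: S_def)
  also have "\<dots> = emeasure lborel (S \<inter> {x. x - a \<in> unit_cell})"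
    by (rule emeasure_lborel_translate) measurable
  also have "\<dots> = emeasure lborel (S \<inter> unit_cell)"
  proof (rule emeasure_fundamental_domains)
    show "\<exists>!n. x + of_int_vec n \<in> {x. x - a \<in> unit_cell}" for x
      using unit_cell_fundamental[of "x - a"] by (simp add: algebra_simps)
  qed (auto simp: S_def torus_of_add_of_int_vec unit_cell_fundamental)
  finally have "emeasure lborel ({x. torus_of (x + a) \<in> A} \<inter> unit_cell) =
      emeasure lborel (S \<inter> unit_cell)" .
  then show "emeasure (distr (restrict_space lborel (cbox 0 1)) borel (\<lambda>x. torus_of (x + a))) A =
      emeasure torus_lebesgue A"
    using shift[of a] shift[of 0] by (simp add: torus_lebesgue_def S_def)
qed (simp add: torus_lebesgue_def)

lemma integral_torus_lebesgue_translate: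
  fixes f :: "'n::finite torus \<Rightarrow> 'b::{banach, second_countable_topology}"
  assumes [measurable]: "f \<in> borel_measurable borel"
  shows "(LINT x|restrict_space lborel (cbox 0 1). f (torus_of (x + a))) = integral\<^sup>L torus_lebesgue f"
  unfolding torus_lebesgue_translate[of a, symmetric]
  by (subst integral_distr) (auto intro!: measurable_restrict_space1)

lemma sets_torus_lebesgue [measurable_cong]: "sets torus_lebesgue = sets borel"
  by (simp add: torus_lebesgue_def)

lemma space_torus_lebesgue [simp]: "space torus_lebesgue = UNIV"
  by (simp add: torus_lebesgue_def)

section \<open>Characters\<close>

lemma norm_torus_char [simp]: "norm (torus_char k p) = 1"
proof -
  obtain x where "p = torus_of x" using surj_torus_of by (metis surjD)
  then show ?thesis by (simp add: torus_char_torus_of)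
qed

lemma torus_char_translate:
  "torus_char k (torus_of (x + y)) = torus_char k (torus_of x) * torus_char k (torus_of y)"
  unfolding torus_char_torus_of exp_add[symmetric]
  by (rule arg_cong[of _ _ exp]) (simp add: algebra_simps sum.distrib)

lemma torus_char_diff: "torus_char (k - l) p = torus_char k p * cnj (torus_char l p)"
proof -
  obtain x where "p = torus_of x" using surj_torus_of by (metis surjD)
  then show ?thesis
    unfolding \<open>p = torus_of x\<close> torus_char_torus_of exp_cnj exp_add[symmetric]
    by (intro arg_cong[of _ _ exp]) (simp add: algebra_simps sum_subtractf)
qed

lemma torus_char_0 [simp]: "torus_char 0 p = 1"
proof -
  obtain x where "p = torus_of x" using surj_torus_of by (metis surjD)
  then show ?thesis by (simp add: torus_char_torus_of)
qed

lemma torus_char_at_0 [simp]: "torus_char k (torus_of 0) = 1"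
  by (simp add: torus_char_torus_of)

text \<open>With \<open>y\<close> a lift of \<open>q\<close> nearest to \<open>x\<close>, the torus
  distance equals the Euclidean one. The bound then follows from |exp(i t) - 1| = 2 |sin(t/2)| \<le>
  |t| and Cauchy-Schwarz for the phase.\<close>

lemma dist_torus_char_le: "dist (torus_char k p) (torus_char k q) \<le> 2 * pi * freq_norm k * dist p q"
proof -
  obtain x where p: "p = torus_of x" using surj_torus_of by (metis surjD)
  obtain y where q: "q = torus_of y" and d: "dist x y = dist p q"
    using torus_of_nearest_lift[where x = x and p = q] p by auto
  define v where "v = (\<chi> i. real_of_int (k $ i))"
  have char: "torus_char k (torus_of z) = exp (\<i> * of_real (2 * pi * (v \<bullet> z)))" for z
    by (simp add: torus_char_torus_of v_def inner_vec_def mult_ac)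
  have "torus_char k p = torus_char k (torus_of (x - y)) * torus_char k q"
    using torus_char_translate[of k "x - y" y] by (simp add: p q)
  then have "torus_char k p - torus_char k q = (torus_char k (torus_of (x - y)) - 1) * torus_char k q"
    by (simp add: algebra_simps)
  then have "dist (torus_char k p) (torus_char k q) = norm (torus_char k (torus_of (x - y)) - 1)"
    by (simp add: dist_norm norm_mult)
  also have "\<dots> = 2 * \<bar>sin (2 * pi * (v \<bullet> (x - y)) / 2)\<bar>"
    unfolding char by (rule dist_exp_i_1)
  also have "\<dots> \<le> 2 * \<bar>2 * pi * (v \<bullet> (x - y)) / 2\<bar>"
    using abs_sin_x_le_abs_x by (intro mult_left_mono) auto
  also have "\<dots> = 2 * pi * \<bar>v \<bullet> (x - y)\<bar>" by (simp add: abs_mult)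
  also have "\<dots> \<le> 2 * pi * (norm v * norm (x - y))"
    using Cauchy_Schwarz_ineq2 by (intro mult_left_mono) auto
  finally show ?thesis
    using d by (simp add: v_def freq_norm_def dist_norm)
qed

lemma freq_norm_nonneg: "0 \<le> freq_norm k"
  by (simp add: freq_norm_def)

lemma borel_measurable_torus_char [measurable]: "torus_char k \<in> borel_measurable borel"
proof (rule borel_measurable_continuous_onI)
  have "(2 * pi * freq_norm k)-lipschitz_on UNIV (torus_char k)"
    using dist_torus_char_le by (intro lipschitz_onI) (auto simp: freq_norm_nonneg)
  then show "continuous_on UNIV (torus_char k)" by (rule lipschitz_on_continuous_on)
qed

text \<open>Translating by \<open>e\<^sub>i / (2 k\<^sub>i)\<close> changes the sign of the character, but not its integral.\<close>

lemma integral_torus_char_eq_0: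
  fixes k :: "int ^ 'n::finite"
  assumes "k \<noteq> 0"
  shows "integral\<^sup>L torus_lebesgue (torus_char k) = 0"
proof -
  obtain i where i: "k $ i \<noteq> 0" using assms by (auto simp: vec_eq_iff)
  define a :: "real ^ 'n" where "a = axis i (1 / (2 * of_int (k $ i)))"
  have "(\<Sum>j\<in>UNIV. of_int (k $ j) * a $ j) = (\<Sum>j\<in>UNIV. if j = i then 1 / 2 else (0::real))"
    using i by (intro sum.cong) (auto simp: a_def axis_def)
  also have "\<dots> = 1 / 2" by simp
  finally have "torus_char k (torus_of a) = exp (2 * of_real pi * \<i> * of_real (1 / 2))"
    by (simp only: torus_char_torus_of)
  also have "\<dots> = -1" by (simp add: exp_pi_i')
  finally have "torus_char k (torus_of a) = -1" .
  then have "integral\<^sup>L torus_lebesgue (torus_char k) =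
      (LINT x|restrict_space lborel (cbox 0 1). - torus_char k (torus_of x))"
    by (subst integral_torus_lebesgue_translate[symmetric, where a = a]) (auto simp: torus_char_translate)
  also have "\<dots> = - integral\<^sup>L torus_lebesgue (torus_char k)"
    using integral_torus_lebesgue_translate[of "torus_char k" 0] by simp
  finally show ?thesis by simp
qed

lemma integral_torus_char_orthonormal:
  "(LINT p|torus_lebesgue. torus_char k p * cnj (torus_char l p)) = (if k = l then 1 else 0)"
proof -
  interpret prob_space "torus_lebesgue :: ('a torus) measure" by (rule prob_space_torus_lebesgue)
  show ?thesis
    using integral_torus_char_eq_0[of "k - l"] prob_space
    by (simp add: torus_char_diff[symmetric])
qed

text \<open>The torus is not an instance of \<open>second_countable_topology\<close>, so measurability of the
  distance on the product \<open>\<sigma>\<close>-algebra is derived from a countable dense set.\<close>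

lemma sets_dist_less:
  fixes r :: real
  shows "{z. dist (fst z) (snd z) < r} \<in> sets (borel \<Otimes>\<^sub>M borel :: (('n::finite torus) \<times> 'n torus) measure)"
proof -
  obtain D :: "(real ^ 'n) set" where D: "countable D" "\<And>X. open X \<Longrightarrow> X \<noteq> {} \<Longrightarrow> \<exists>d\<in>D. d \<in> X"
    by (rule countable_dense_setE) blast
  have dense: "\<exists>x\<in>D. dist (torus_of x) p < e" if "e > 0" for p :: "'n torus" and e :: real
  proof -
    obtain y where "p = torus_of y" using surj_torus_of by (metis surjD)
    moreover obtain x where "x \<in> D" "x \<in> ball y e" using D(2)[of "ball y e"] \<open>e > 0\<close> by auto
    ultimately show ?thesis
      using dist_torus_of_le[of x y] by (auto simp: dist_commute intro!: bexI[of _ x])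
  qed
  \<comment> \<open>Two points are closer than \<open>r\<close> exactly when some point of the dense
    family is within \<open>s\<close> of the first and within \<open>r - s\<close> of the second.
    Rational \<open>s\<close> suffice, so the union of products of balls is countable.\<close>
  have "{z. dist (fst z) (snd z) < r} =
      (\<Union>x\<in>D. \<Union>s\<in>\<rat>. ball (torus_of x) s \<times> ball (torus_of x :: 'n torus) (r - s))"
  proof (intro equalityI subsetI)
    fix z :: "'n torus \<times> 'n torus"
    assume "z \<in> {z. dist (fst z) (snd z) < r}"
    then obtain p q where z: "z = (p, q)" and "dist p q < r" by (cases z) auto
    \<comment> \<open>With a third of the slack, \<open>dist p q = r - 3 * e\<close>, so the dense
      point has distance less than \<open>r - 2 * e\<close> from \<open>q\<close>, which is below
      \<open>r - s\<close> because \<open>s < e\<close>.\<close>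
    define e where "e = (r - dist p q) / 3"
    have "e > 0" using \<open>dist p q < r\<close> by (simp add: e_def)
    then obtain x where x: "x \<in> D" "dist (torus_of x) p < e" using dense by blast
    obtain s where s: "s \<in> \<rat>" "dist (torus_of x) p < s" "s < e" using Rats_dense_in_real x(2) by blast
    have "dist (torus_of x) q \<le> dist (torus_of x) p + dist p q" by (rule dist_triangle)
    then have "dist (torus_of x) q < r - s" using s x \<open>e > 0\<close> by (simp add: e_def field_simps)
    then show "z \<in> (\<Union>x\<in>D. \<Union>s\<in>\<rat>. ball (torus_of x) s \<times> ball (torus_of x) (r - s))"
      using x s z by auto
  next
    fix z :: "'n torus \<times> 'n torus"
    assume "z \<in> (\<Union>x\<in>D. \<Union>s\<in>\<rat>. ball (torus_of x) s \<times> ball (torus_of x) (r - s))"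
    then obtain x s where "dist (torus_of x) (fst z) < s" "dist (torus_of x) (snd z) < r - s" by auto
    then show "z \<in> {z. dist (fst z) (snd z) < r}"
      using dist_triangle3[of "fst z" "snd z" "torus_of x"] by simp
  qed
  also have "\<dots> \<in> sets (borel \<Otimes>\<^sub>M borel)"
    using D(1) by (intro sets.countable_UN' pair_measureI) (auto simp: countable_rat)
  finally show ?thesis .
qed

lemma ball_sets_borel [measurable]: "ball (p :: 'a::metric_space) r \<in> sets borel"
  by simp

lemma borel_measurable_cnj [measurable]: "cnj \<in> borel_measurable borel"
  by (intro borel_measurable_continuous_onI continuous_intros)

section \<open>Fourier coefficients and balls\<close>

definition ball_coeff :: "real \<Rightarrow> int ^ 'n::finite \<Rightarrow> complex"
  where "ball_coeff r k =
    (LINT q|torus_lebesgue. of_real (indicator (ball (torus_of 0) r) q) * torus_char k q)"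

text \<open>Translating by a lift of \<open>p\<close> moves the ball to the origin and pulls out the
  factor \<open>torus_char k p\<close>. This is what turns the convolution with a ball into a
  product of coefficients.\<close>

lemma integral_ball_torus_char:
  "(LINT q|torus_lebesgue. of_real (indicator (ball p r) q) * torus_char k q) =
    torus_char k p * ball_coeff r k"
proof -
  obtain a where p: "p = torus_of a" using surj_torus_of by (metis surjD)
  have "(LINT q|torus_lebesgue. of_real (indicator (ball p r) q) * torus_char k q) =
      (LINT x|restrict_space lborel (cbox 0 1).
        of_real (indicator (ball p r) (torus_of (x + a))) * torus_char k (torus_of (x + a)))"
    by (rule integral_torus_lebesgue_translate[symmetric]) measurable
  \<comment> \<open>The summand \<open>0\<close> is written out so that translation invariance
    applies again, now with the zero vector.\<close>
  also have "\<dots> = (LINT x|restrict_space lborel (cbox 0 1).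
        torus_char k p * (of_real (indicator (ball (torus_of 0) r) (torus_of (x + 0))) *
          torus_char k (torus_of (x + 0))))"
    using dist_torus_of_translate[of 0 a]
    by (intro Bochner_Integration.integral_cong)
      (auto simp: torus_char_translate p indicator_def)
  also have "\<dots> = torus_char k p * (LINT x|restrict_space lborel (cbox 0 1).
        of_real (indicator (ball (torus_of 0) r) (torus_of (x + 0))) * torus_char k (torus_of (x + 0)))"
    by simp
  also have "\<dots> = torus_char k p * ball_coeff r k"
    unfolding ball_coeff_def
    by (subst integral_torus_lebesgue_translate) auto
  finally show ?thesis .
qed

lemma integrable_torus_bounded:
  fixes f :: "'n::finite torus \<Rightarrow> 'b::{banach, second_countable_topology}"
  assumes "finite_measure M" "sets M = sets borel" "f \<in> borel_measurable borel" "\<And>x. norm (f x) \<le> B"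
  shows "integrable M f"
  using assms by (intro finite_measure.integrable_const_bound[of M _ B])
    (auto simp: measurable_cong_sets[OF assms(2) refl])

lemma finite_measure_torus_lebesgue: "finite_measure torus_lebesgue"
  using prob_space_torus_lebesgue by (rule prob_space.finite_measure)

lemma ball_coeff_0:
  "ball_coeff r (0 :: int ^ 'n::finite) = of_real (measure torus_lebesgue (ball (torus_of (0 :: real ^ 'n)) r))"
  by (simp add: ball_coeff_def)

text \<open>On the ball the character differs from 1 by at most
  \<open>2 * pi * freq_norm k * r\<close>, hence by at most 1/2, so the coefficient differs from the
  volume of the ball by at most half that volume.\<close>

lemma norm_ball_coeff_ge:
  fixes k :: "int ^ 'n::finite"
  assumes "4 * pi * freq_norm k * r \<le> 1"
  shows "measure torus_lebesgue (ball (torus_of (0 :: real ^ 'n)) r) / 2 \<le> norm (ball_coeff r k)"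
proof -
  let ?B = "ball (torus_of (0 :: real ^ 'n)) r"
  let ?m = "measure torus_lebesgue ?B"
  have int: "integrable torus_lebesgue (\<lambda>q. complex_of_real (indicator ?B q) * torus_char l q)" for l :: "int ^ 'n"
    by (rule integrable_torus_bounded[where B = 1, OF finite_measure_torus_lebesgue sets_torus_lebesgue])
      (measurable, auto simp: norm_mult indicator_def)
  have "(LINT q|torus_lebesgue. complex_of_real (indicator ?B q) * torus_char k q -
      complex_of_real (indicator ?B q) * torus_char 0 q) = ball_coeff r k - ball_coeff r (0 :: int ^ 'n)"
    unfolding ball_coeff_def by (rule Bochner_Integration.integral_diff[OF int int])
  then have "norm (ball_coeff r k - ball_coeff r (0 :: int ^ 'n)) =
      norm (LINT q|torus_lebesgue. complex_of_real (indicator ?B q) * (torus_char k q - 1))"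
    by (simp only: right_diff_distrib torus_char_0)
  also have "\<dots> \<le> (LINT q|torus_lebesgue. indicator ?B q * (1 / 2))"
  proof (rule order_trans[OF integral_norm_bound], rule integral_mono[OF integrable_norm])
    show "integrable torus_lebesgue (\<lambda>q. complex_of_real (indicator ?B q) * (torus_char k q - 1))"
      using Bochner_Integration.integrable_diff[OF int[of k] int[of 0]] by (simp add: algebra_simps)
    show "integrable torus_lebesgue (\<lambda>q. indicator ?B q * (1 / 2 :: real))"
      by (rule integrable_torus_bounded[where B = 1, OF finite_measure_torus_lebesgue sets_torus_lebesgue])
        (measurable, auto simp: indicator_def)
    fix q :: "'n torus"
    show "norm (complex_of_real (indicator ?B q) * (torus_char k q - 1)) \<le> indicator ?B q * (1 / 2)"
    proof (cases "q \<in> ?B")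
      case True
      have "norm (torus_char k q - 1) \<le> 2 * pi * freq_norm k * dist q (torus_of 0)"
        using dist_torus_char_le[of k q "torus_of 0"] by (simp add: dist_norm)
      also have "\<dots> \<le> 2 * pi * freq_norm k * r"
        using True by (intro mult_left_mono) (auto simp: dist_commute freq_norm_nonneg)
      finally show ?thesis using assms True by simp
    qed auto
  qed
  also have "\<dots> = ?m / 2" by simp
  finally have "norm (ball_coeff r k - of_real ?m) \<le> ?m / 2" by (simp add: ball_coeff_0)
  then have "norm (complex_of_real ?m) - norm (ball_coeff r k) \<le> ?m / 2"
    using norm_triangle_ineq2[of "complex_of_real ?m" "ball_coeff r k"] by (simp add: norm_minus_commute)
  then show ?thesis by simp
qed

text \<open>Expand the nonnegative integral of |g - S|^2, where \<open>S\<close> is the Fourier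
  partial sum over \<open>F\<close>. By orthonormality the cross integral and the integral of |S|^2
  both equal \<open>T\<close>, leaving the integral of g^2 minus \<open>T\<close>.\<close>

lemma torus_bessel_inequality:
  fixes g :: "'n::finite torus \<Rightarrow> real"
  assumes [measurable]: "g \<in> borel_measurable borel" and g: "\<And>p. \<bar>g p\<bar> \<le> B" and "finite F"
  shows "(\<Sum>k\<in>F. (norm (LINT p|torus_lebesgue. of_real (g p) * torus_char k p))\<^sup>2) \<le>
    (LINT p|torus_lebesgue. (g p)\<^sup>2)"
proof -
  note integrable = integrable_torus_bounded[OF finite_measure_torus_lebesgue sets_torus_lebesgue]
  define c where "c k = (LINT p|torus_lebesgue. complex_of_real (g p) * torus_char k p)" for k
  \<comment> \<open>The coefficient \<open>c k\<close> pairs \<open>g\<close> with the character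
    itself, not with its conjugate, so the expansion runs over conjugate characters.\<close>
  define S where "S p = (\<Sum>k\<in>F. c k * cnj (torus_char k p))" for p
  define T where "T = (\<Sum>k\<in>F. (norm (c k))\<^sup>2)"
  have "0 \<le> B" using g[of undefined] by simp
  have int_g: "integrable torus_lebesgue (\<lambda>p. complex_of_real (g p) * torus_char k p)" for k
    by (rule integrable[where B = B]) (measurable, auto simp: norm_mult g)
  have int_g2: "integrable torus_lebesgue (\<lambda>p. (g p)\<^sup>2)"
    by (rule integrable[where B = "B\<^sup>2"]) (auto simp: g abs_le_square_iff[symmetric] \<open>0 \<le> B\<close>)
  have int_char: "integrable torus_lebesgue (\<lambda>p. torus_char k p * cnj (torus_char l p))" for k l :: "int ^ 'n"
    by (rule integrable[where B = 1]) (measurable, auto simp: norm_mult)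
  have gS: "complex_of_real (g p) * cnj (S p) = (\<Sum>k\<in>F. cnj (c k) * (of_real (g p) * torus_char k p))" for p
    by (simp add: S_def sum_distrib_left mult_ac)
  have int_gS: "integrable torus_lebesgue (\<lambda>p. complex_of_real (g p) * cnj (S p))"
    unfolding gS by (intro Bochner_Integration.integrable_sum integrable_mult_right int_g)
  have "(LINT p|torus_lebesgue. complex_of_real (g p) * cnj (S p)) = (\<Sum>k\<in>F. cnj (c k) * c k)"
    unfolding gS by (subst Bochner_Integration.integral_sum) (auto simp: int_g c_def)
  also have "\<dots> = of_real T"
    by (simp add: T_def complex_norm_square mult.commute del: of_real_power)
  finally have eq_gS: "(LINT p|torus_lebesgue. complex_of_real (g p) * cnj (S p)) = of_real T" .
  have SS: "S p * cnj (S p) = (\<Sum>k\<in>F. \<Sum>l\<in>F. c k * cnj (c l) * (torus_char l p * cnj (torus_char k p)))" for p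
    by (simp add: S_def sum_product mult_ac)
  have int_SS: "integrable torus_lebesgue (\<lambda>p. S p * cnj (S p))"
    unfolding SS by (intro Bochner_Integration.integrable_sum integrable_mult_right int_char)
  have "(LINT p|torus_lebesgue. S p * cnj (S p)) =
      (\<Sum>k\<in>F. \<Sum>l\<in>F. c k * cnj (c l) * (LINT p|torus_lebesgue. torus_char l p * cnj (torus_char k p)))"
    unfolding SS
    by (subst Bochner_Integration.integral_sum Bochner_Integration.integrable_sum,
        intro Bochner_Integration.integrable_sum integrable_mult_right int_char)+ simp
  also have "\<dots> = (\<Sum>k\<in>F. c k * cnj (c k))"
    using \<open>finite F\<close> by (simp add: integral_torus_char_orthonormal if_distrib cong: if_cong)
  also have "\<dots> = of_real T"
    by (simp add: T_def complex_norm_square del: of_real_power)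
  finally have eq_SS: "(LINT p|torus_lebesgue. S p * cnj (S p)) = of_real T" .
  have expand: "(norm (of_real (g p) - S p))\<^sup>2 =
      (g p)\<^sup>2 - 2 * Re (of_real (g p) * cnj (S p)) + Re (S p * cnj (S p))" for p
    unfolding cmod_power2 by (simp add: power2_eq_square algebra_simps)
  have "0 \<le> (LINT p|torus_lebesgue. (norm (of_real (g p) - S p))\<^sup>2)"
    by (rule Bochner_Integration.integral_nonneg) simp
  also have "\<dots> = (LINT p|torus_lebesgue. (g p)\<^sup>2) - 2 * T + T"
    unfolding expand
    using int_g2 int_gS int_SS eq_gS eq_SS
    by (simp add: integral_Re del: times_complex.sel)
  finally show ?thesis by (simp add: T_def c_def)
qed

lemma sum_fourier_ball_le:
  fixes \<mu> :: "('n::finite torus) measure"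
  assumes "prob_space \<mu>" and sets_\<mu> [measurable_cong]: "sets \<mu> = sets borel"
    and "finite F" and freq: "\<And>k. k \<in> F \<Longrightarrow> 4 * pi * freq_norm k * r \<le> 1"
    and s: "\<And>p. measure \<mu> (ball p r) \<le> s"
  shows "(\<Sum>k\<in>F. (norm (integral\<^sup>L \<mu> (torus_char k)))\<^sup>2) *
    measure torus_lebesgue (ball (torus_of (0 :: real ^ 'n)) r) \<le> 4 * s"
proof -
  interpret L: prob_space "torus_lebesgue :: ('n torus) measure" by (rule prob_space_torus_lebesgue)
  interpret M: prob_space \<mu> by fact
  interpret pair_prob_space "torus_lebesgue :: ('n torus) measure" \<mu> ..
  define m where "m = measure torus_lebesgue (ball (torus_of (0 :: real ^ 'n)) r)"
  define g where "g q = measure \<mu> (ball q r)" for q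
  \<comment> \<open>After Fubini the inner integral runs over the centre \<open>q\<close>; symmetry
    of the distance turns it into an integral over the ball around \<open>p\<close>.\<close>
  have sym: "indicator (ball q r) p = (indicator (ball p r) q :: real)" for p q :: "'n torus"
    by (simp add: indicator_def dist_commute)
  have [measurable]: "(\<lambda>z. indicator (ball (fst z) r) (snd z) :: real) \<in>
      borel_measurable (borel \<Otimes>\<^sub>M borel :: ('n torus \<times> 'n torus) measure)"
  proof -
    have "(\<lambda>z. indicator (ball (fst z) r) (snd z) :: real) =
        indicator {z :: 'n torus \<times> 'n torus. dist (fst z) (snd z) < r}"
      by (auto simp: indicator_def)
    then show ?thesis
      using borel_measurable_indicator[OF sets_dist_less[of r]] by (simp only:)
  qed
  have g_eq: "g q = (LINT p|\<mu>. indicator (ball q r) p)" for q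
    by (simp add: g_def)
  have [measurable]: "g \<in> borel_measurable borel"
    unfolding g_eq[abs_def] by (rule M.borel_measurable_lebesgue_integral) (simp add: split_beta')
  have convolution: "(LINT q|torus_lebesgue. of_real (g q) * torus_char k q) =
      integral\<^sup>L \<mu> (torus_char k) * ball_coeff r k" for k
  proof -
    let ?f = "\<lambda>q p. complex_of_real (indicator (ball q r) p) * torus_char k q"
    have "integrable (torus_lebesgue \<Otimes>\<^sub>M \<mu>) (case_prod ?f)"
    proof (rule P.integrable_const_bound[where B = 1])
      show "case_prod ?f \<in> borel_measurable (torus_lebesgue \<Otimes>\<^sub>M \<mu>)"
        unfolding split_beta' by measurable
      show "AE z in torus_lebesgue \<Otimes>\<^sub>M \<mu>. norm (case_prod ?f z) \<le> 1"
        by (intro AE_I2) (auto simp: norm_mult indicator_def)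
    qed
    then have "(LINT q|torus_lebesgue. LINT p|\<mu>. ?f q p) = (LINT p|\<mu>. LINT q|torus_lebesgue. ?f q p)"
      by (rule Fubini_integral[symmetric])
    also have "\<dots> = (LINT p|\<mu>. torus_char k p * ball_coeff r k)"
      using integral_ball_torus_char[where r = r and k = k] by (simp only: sym)
    also have "\<dots> = integral\<^sup>L \<mu> (torus_char k) * ball_coeff r k" by simp
    finally show ?thesis by (simp add: g_def)
  qed
  have g_bounds: "0 \<le> g q" "\<bar>g q\<bar> \<le> 1" "g q \<le> s" for q
    using s by (auto simp: g_def)
  have int_g: "integrable torus_lebesgue g" "integrable torus_lebesgue (\<lambda>q. s * g q)"
    using g_bounds
    by (auto intro!: integrable_mult_right
        integrable_torus_bounded[where B = 1, OF finite_measure_torus_lebesgue sets_torus_lebesgue])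
  \<comment> \<open>The mean of \<open>g\<close> is the convolution identity at frequency 0, since
    \<open>\<mu>\<close> has total mass 1.\<close>
  have "complex_of_real (integral\<^sup>L torus_lebesgue g) = of_real m"
  proof -
    have "torus_char (0 :: int ^ 'n) = (\<lambda>p. 1)" by auto
    then show ?thesis using convolution[of 0] by (simp add: ball_coeff_0 m_def M.prob_space)
  qed
  then have mean_g: "integral\<^sup>L torus_lebesgue g = m" by (simp only: of_real_eq_iff)
  have "(m / 2)\<^sup>2 * (\<Sum>k\<in>F. (norm (integral\<^sup>L \<mu> (torus_char k)))\<^sup>2) =
      (\<Sum>k\<in>F. (norm (integral\<^sup>L \<mu> (torus_char k)))\<^sup>2 * (m / 2)\<^sup>2)"
    by (simp add: sum_distrib_left mult.commute)
  also have "\<dots> \<le> (\<Sum>k\<in>F. (norm (LINT q|torus_lebesgue. of_real (g q) * torus_char k q))\<^sup>2)"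
    unfolding convolution norm_mult power_mult_distrib
    using norm_ball_coeff_ge[OF freq]
    by (intro sum_mono mult_left_mono power_mono) (auto simp: m_def)
  also have "\<dots> \<le> (LINT q|torus_lebesgue. (g q)\<^sup>2)"
    by (rule torus_bessel_inequality[where B = 1]) (use g_bounds \<open>finite F\<close> in auto)
  \<comment> \<open>Here \<open>0 \<le> g \<le> s\<close> gives g^2 \<le> s g pointwise.\<close>
  also have "\<dots> \<le> (LINT q|torus_lebesgue. s * g q)"
    using g_bounds
    by (intro integral_mono int_g
        integrable_torus_bounded[where B = 1, OF finite_measure_torus_lebesgue sets_torus_lebesgue])
      (auto simp: power2_eq_square mult_right_mono abs_mult mult_le_one)
  also have "\<dots> = s * m" by (simp add: mean_g)
  finally have "m * (m * (\<Sum>k\<in>F. (norm (integral\<^sup>L \<mu> (torus_char k)))\<^sup>2)) \<le> m * (4 * s)"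
    by (simp add: power2_eq_square algebra_simps)
  moreover have "0 \<le> m" by (simp add: m_def)
  moreover have "0 \<le> s" using g_bounds[of undefined] by linarith
  \<comment> \<open>One factor \<open>m\<close> cancels when it is positive; for
    \<open>m = 0\<close> the claim reduces to \<open>0 \<le> 4 * s\<close>.\<close>
  ultimately have "m * (\<Sum>k\<in>F. (norm (integral\<^sup>L \<mu> (torus_char k)))\<^sup>2) \<le> 4 * s"
    by (cases "m = 0") (auto simp: mult_le_cancel_left)
  then show ?thesis by (simp add: m_def mult.commute)
qed

section \<open>Lower and upper bounds for the measure of balls\<close>

lemma measure_torus_ball_ge:
  assumes "0 < r" "r \<le> 1"
  shows "(r / (2 * real CARD('n::finite))) ^ CARD('n) \<le>
    measure torus_lebesgue (ball (torus_of (0 :: real ^ 'n)) r)"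
proof -
  \<comment> \<open>A cube of side \<open>c\<close> at the origin fits into the ball: its points
    have Euclidean norm at most their sum of coordinates, which is at most \<open>r / 2\<close>.
    Moreover \<open>c \<le> 1\<close> keeps it inside the unit cube.\<close>
  define c where "c = r / (2 * real CARD('n))"
  define B where "B = ball (torus_of (0 :: real ^ 'n)) r"
  have d: "1 \<le> real CARD('n)" by (simp add: Suc_le_eq)
  then have d2: "1 \<le> 2 * real CARD('n)" by linarith
  have "c \<le> r / 1"
    unfolding c_def
    by (intro divide_left_mono d2) (use \<open>0 < r\<close> in auto)
  then have "c \<le> 1" using assms by linarith
  have "0 < c" using assms by (simp add: c_def)
  note c = \<open>0 < c\<close> \<open>c \<le> 1\<close>
  have meas: "{x. torus_of x \<in> B} \<in> sets borel" unfolding B_def by measurable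
  have sub: "cbox (0 :: real ^ 'n) (\<chi> i. c) \<subseteq> {x. torus_of x \<in> B} \<inter> cbox 0 1"
  proof
    fix x :: "real ^ 'n"
    assume x: "x \<in> cbox 0 (\<chi> i. c)"
    have "norm x \<le> (\<Sum>i\<in>UNIV. \<bar>x $ i\<bar>)" by (rule norm_le_l1_cart)
    also have "\<dots> \<le> (\<Sum>i\<in>(UNIV :: 'n set). c)"
      using x by (intro sum_mono) (auto simp: mem_box_cart abs_le_iff intro: order_trans[of _ 0])
    also have "\<dots> < r" using \<open>0 < r\<close> d by (simp add: c_def)
    finally have "torus_of x \<in> B"
      using dist_torus_of_le[of 0 x] by (simp add: B_def)
    moreover have "x \<in> cbox 0 1"
      using x c by (auto simp: mem_box_cart intro: order_trans)
    ultimately show "x \<in> {x. torus_of x \<in> B} \<inter> cbox 0 1" by simp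
  qed
  have "ennreal (c ^ CARD('n)) = emeasure lborel (cbox (0 :: real ^ 'n) (\<chi> i. c))"
  proof -
    have "measure lborel (cbox (0 :: real ^ 'n) (\<chi> i. c)) = c ^ CARD('n)"
      using c by (subst content_cbox_cart) (auto simp: interval_eq_empty_cart not_less)
    then show ?thesis
      using emeasure_lborel_cbox_finite[of 0 "(\<chi> i. c) :: real ^ 'n"]
      by (simp add: emeasure_eq_ennreal_measure less_top[symmetric])
  qed
  also have "\<dots> \<le> emeasure lborel ({x. torus_of x \<in> B} \<inter> cbox 0 1)"
    using meas by (intro emeasure_mono sub) auto
  also have "\<dots> = emeasure torus_lebesgue B"
    unfolding torus_lebesgue_def
    by (subst emeasure_distr)
      (auto simp: B_def space_restrict_space vimage_def Int_def
        intro!: measurable_restrict_space1 emeasure_restrict_space[symmetric])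
  also have "\<dots> = ennreal (measure torus_lebesgue B)"
    by (intro finite_measure.emeasure_eq_measure finite_measure_torus_lebesgue)
  finally show ?thesis by (simp add: c_def B_def)
qed

text \<open>Every point outside the support has an open null neighbourhood, and compactness leaves
  finitely many of them. A null superset is produced because a compact set in a general topological
  space may fail to be Borel.\<close>

lemma supp_disjoint_compact_null:
  assumes "sets \<mu> = sets borel" "compact K" "K \<inter> supp \<mu> = {}"
  shows "\<exists>U \<in> null_sets \<mu>. K \<subseteq> U"
proof -
  have "\<exists>U. open U \<and> x \<in> U \<and> emeasure \<mu> U = 0" if "x \<in> K" for x
    using assms(3) that unfolding supp_def zero_less_iff_neq_zero by blast
  then obtain U where U: "\<And>x. x \<in> K \<Longrightarrow> open (U x) \<and> x \<in> U x \<and> emeasure \<mu> (U x) = 0"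
    by metis
  then have "K \<subseteq> (\<Union>x\<in>K. U x)" by blast
  then obtain D where D: "D \<subseteq> K" "finite D" "K \<subseteq> (\<Union>x\<in>D. U x)"
    using compactE_image[OF assms(2), of K U] U by blast
  moreover have "(\<Union>x\<in>D. U x) \<in> null_sets \<mu>"
    using D U assms(1) by (intro null_sets.finite_UN) (auto intro!: null_setsI)
  ultimately show ?thesis by blast
qed

text \<open>Regularity speaks only of centres in the support. If the closed ball contains a support
  point \<open>q\<close>, the ball lies in the ball of radius \<open>2 * r\<close> around
  \<open>q\<close>, and \<open>r \<le> 1 / 2\<close> keeps that radius admissible; otherwise the
  ball is null.\<close>

lemma upper_ahlfors_regular_ball_le:
  fixes \<mu> :: "('n::finite torus) measure"
  assumes "upper_ahlfors_regular \<alpha> M \<mu>" "finite_measure \<mu>" "sets \<mu> = sets borel"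
    and "0 < r" "r \<le> 1 / 2" "0 < M"
  shows "measure \<mu> (ball p r) \<le> M * (2 * r) powr \<alpha>"
proof (cases "cball p r \<inter> supp \<mu> = {}")
  case True
  have compact: "compact (cball p r)"
    using compact_Int_closed[OF compact_torus, of "cball p r"] by simp
  then obtain U where "U \<in> null_sets \<mu>" "cball p r \<subseteq> U"
    using supp_disjoint_compact_null[OF assms(3) compact True] by blast
  then have "ball p r \<in> null_sets \<mu>"
    using assms(3) ball_subset_cball[of p r] by (intro null_sets_subset[of U \<mu> "ball p r"]) auto
  then show ?thesis
    using assms by (simp add: measure_def null_setsD1)
next
  case False
  then obtain q where q: "q \<in> supp \<mu>" "dist p q \<le> r" by auto
  have "ball p r \<subseteq> ball q (2 * r)"
  proof
    fix x assume "x \<in> ball p r"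
    then show "x \<in> ball q (2 * r)"
      using dist_triangle3[of q x p] q(2) by simp
  qed
  then have "emeasure \<mu> (ball p r) \<le> emeasure \<mu> (ball q (2 * r))"
    using assms(3) by (intro emeasure_mono) auto
  also have "\<dots> \<le> ennreal (M * (2 * r) powr \<alpha>)"
  proof -
    have "2 * r \<in> {0<..1}" using assms by simp
    then show ?thesis using assms(1) q(1) unfolding upper_ahlfors_regular_def by blast
  qed
  finally show ?thesis
    using assms by (simp add: finite_measure.emeasure_eq_measure)
qed

text \<open>Lebesgue measure contributes nothing at nonzero frequencies.\<close>

lemma fourier_coeff_signed_diff:
  fixes \<mu> :: "('n::finite torus) measure"
  assumes "finite_measure \<mu>" "sets \<mu> = sets borel" "k \<noteq> 0"
  shows "fourier_coeff (signed_diff \<mu> torus_lebesgue) k = integral\<^sup>L \<mu> (torus_char k)"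
  unfolding fourier_coeff_def
  using assms integral_torus_char_eq_0[of k]
  by (subst signed_integral_signed_diff[where B = 1])
    (auto simp: finite_measure_torus_lebesgue sets_torus_lebesgue)

section \<open>Dyadic summation\<close>

lemma freq_norm_ge_1:
  assumes "k \<noteq> 0"
  shows "1 \<le> freq_norm k"
proof -
  obtain i where "k $ i \<noteq> 0" using assms by (auto simp: vec_eq_iff)
  then have "1 \<le> \<bar>real_of_int (k $ i)\<bar>" by linarith
  also have "\<dots> \<le> freq_norm k"
    using component_le_norm_cart[of "\<chi> i. real_of_int (k $ i)" i] by (simp add: freq_norm_def)
  finally show ?thesis .
qed

lemma dyadic_interval:
  fixes x :: real
  assumes "1 \<le> x"
  shows "\<exists>j::nat. 2 ^ j \<le> x \<and> x < 2 ^ Suc j"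
proof -
  define j where "j = nat \<lfloor>log 2 x\<rfloor>"
  have "0 \<le> log 2 x" using assms by simp
  then have "real j \<le> log 2 x" "log 2 x < real (Suc j)" unfolding j_def by linarith+
  then have "2 powr real j \<le> x" "x < 2 powr real (Suc j)"
    using assms by (auto simp: le_log_iff log_less_iff)
  then show ?thesis by (metis powr_realpow zero_less_numeral)
qed

text \<open>At frequency scale \<open>t\<close>, the weight gives
  \<open>t powr (2 * - \<gamma>)\<close>, the mass of balls \<open>t powr - \<alpha>\<close>, and
  the inverse volume of balls \<open>t powr real d\<close>; the product is the geometric
  term.\<close>

lemma dyadic_block_le:
  fixes \<mu> :: "('n::finite torus) measure"
  assumes "0 \<le> \<alpha>" "0 \<le> \<gamma>" "0 < M" "prob_space \<mu>" "sets \<mu> = sets borel" "upper_ahlfors_regular \<alpha> M \<mu>"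
    and "finite F" and F: "\<And>k. k \<in> F \<Longrightarrow> 2 ^ j \<le> freq_norm k \<and> freq_norm k < 2 ^ Suc j"
  shows "(\<Sum>k\<in>F. freq_norm k powr (2 * - \<gamma>) * (norm (integral\<^sup>L \<mu> (torus_char k)))\<^sup>2) \<le>
    4 * (64 * real CARD('n)) ^ CARD('n) * M * (2 powr (real CARD('n) - \<alpha> - 2 * \<gamma>)) ^ j"
proof -
  interpret prob_space \<mu> by fact
  define t :: real where "t = 2 ^ j"
  \<comment> \<open>On the shell \<open>freq_norm k < 2 * t\<close> and \<open>pi < 4\<close>, so 32
    ensures \<open>4 * pi * freq_norm k * r \<le> 1\<close>. It also gives
    \<open>2 * r \<le> 1 / t\<close> for the Ahlfors bound.\<close>
  define r where "r = 1 / (32 * t)"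
  define d where "d = CARD('n)"
  define S where "S = (\<Sum>k\<in>F. (norm (integral\<^sup>L \<mu> (torus_char k)))\<^sup>2)"
  have t: "1 \<le> t" by (simp add: t_def)
  then have r: "0 < r" "r \<le> 1 / 2" by (auto simp: r_def field_simps)
  have "4 * pi * freq_norm k * r \<le> 1" if "k \<in> F" for k
  proof -
    have "4 * pi * freq_norm k \<le> 16 * (2 * t)"
      using F[OF that] pi_less_4 freq_norm_nonneg[of k] by (intro mult_mono) (auto simp: t_def)
    then show ?thesis using t by (simp add: r_def field_simps)
  qed
  moreover have "measure \<mu> (ball p r) \<le> M * t powr - \<alpha>" for p
  proof -
    have "measure \<mu> (ball p r) \<le> M * (2 * r) powr \<alpha>"
      using assms r by (intro upper_ahlfors_regular_ball_le) (auto intro: finite_measure_axioms)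
    also have "\<dots> \<le> M * (1 / t) powr \<alpha>"
      using assms t by (intro mult_left_mono powr_mono2) (auto simp: r_def field_simps)
    also have "\<dots> = M * t powr - \<alpha>"
      using t by (simp add: powr_minus_divide powr_divide)
    finally show ?thesis .
  qed
  ultimately have "S * measure torus_lebesgue (ball (torus_of (0 :: real ^ 'n)) r) \<le> 4 * (M * t powr - \<alpha>)"
    unfolding S_def using assms by (intro sum_fourier_ball_le) auto
  moreover have "S * (r / (2 * real d)) ^ d \<le> S * measure torus_lebesgue (ball (torus_of (0 :: real ^ 'n)) r)"
    unfolding d_def using r by (intro mult_left_mono measure_torus_ball_ge) (auto simp: S_def sum_nonneg)
  ultimately have "S * (r / (2 * real d)) ^ d \<le> 4 * (M * t powr - \<alpha>)" by linarith
  moreover have "(r / (2 * real d)) ^ d = 1 / ((64 * real d) ^ d * t powr real d)"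
  proof -
    have "r / (2 * real d) = 1 / (64 * real d * t)" by (simp add: r_def)
    then show ?thesis using t by (simp add: powr_realpow power_divide power_mult_distrib)
  qed
  moreover have "0 < (64 * real d) ^ d * t powr real d"
    using t by (simp add: d_def)
  ultimately have "S \<le> 4 * (M * t powr - \<alpha>) * ((64 * real d) ^ d * t powr real d)"
    by (simp add: pos_divide_le_eq)
  then have S: "t powr (2 * - \<gamma>) * S \<le>
      t powr (2 * - \<gamma>) * (4 * (M * t powr - \<alpha>) * ((64 * real d) ^ d * t powr real d))"
    by (rule mult_left_mono) simp
  \<comment> \<open>As \<open>\<gamma> \<ge> 0\<close>, the weight is decreasing and is largest at
    the lower end \<open>t\<close> of the shell.\<close>
  have "(\<Sum>k\<in>F. freq_norm k powr (2 * - \<gamma>) * (norm (integral\<^sup>L \<mu> (torus_char k)))\<^sup>2) \<le>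
      (\<Sum>k\<in>F. t powr (2 * - \<gamma>) * (norm (integral\<^sup>L \<mu> (torus_char k)))\<^sup>2)"
    using F assms(2) t by (intro sum_mono mult_right_mono powr_mono2') (auto simp: t_def)
  also have "\<dots> = t powr (2 * - \<gamma>) * S" by (simp add: S_def sum_distrib_left)
  also note S
  also have "t powr (2 * - \<gamma>) * (4 * (M * t powr - \<alpha>) * ((64 * real d) ^ d * t powr real d)) =
      4 * (64 * real d) ^ d * M * (t powr (2 * - \<gamma>) * t powr - \<alpha> * t powr real d)"
    by (simp add: mult_ac)
  also have "t powr (2 * - \<gamma>) * t powr - \<alpha> * t powr real d = t powr (real d - \<alpha> - 2 * \<gamma>)"
    by (simp add: powr_add[symmetric] algebra_simps)
  also have "\<dots> = (2 powr (real d - \<alpha> - 2 * \<gamma>)) ^ j"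
    by (simp add: t_def powr_realpow[symmetric] powr_powr mult.commute)
  finally show ?thesis by (simp add: d_def)
qed

lemma hdot_norm_sq_ahlfors_le:
  fixes \<mu> :: "('n::finite torus) measure"
  assumes "0 \<le> \<alpha>" "\<alpha> \<le> real CARD('n)" and \<gamma>: "(real CARD('n) - \<alpha>) / 2 < \<gamma>"
    and "0 < M" "prob_space \<mu>" "sets \<mu> = sets borel" "upper_ahlfors_regular \<alpha> M \<mu>"
  shows "hdot_norm_sq (- \<gamma>) (signed_diff \<mu> torus_lebesgue) \<le>
    ennreal (4 * (64 * real CARD('n)) ^ CARD('n) / (1 - 2 powr (real CARD('n) - \<alpha> - 2 * \<gamma>)) * M)"
proof -
  interpret prob_space \<mu> by fact
  define q where "q = 2 powr (real CARD('n) - \<alpha> - 2 * \<gamma>)"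
  define K where "K = 4 * (64 * real CARD('n)) ^ CARD('n) * M"
  define a where "a k = freq_norm k powr (2 * - \<gamma>) *
    (norm (fourier_coeff (signed_diff \<mu> torus_lebesgue) k))\<^sup>2" for k
  \<comment> \<open>The bound \<open>q < 1\<close> is exactly the condition on
    \<open>\<gamma>\<close>: it says that the exponent is negative.\<close>
  have q: "0 < q" "q < 1" using \<gamma> by (auto simp: q_def powr_less_one)
  have "0 \<le> K" using \<open>0 < M\<close> by (simp add: K_def)
  obtain J where J: "\<And>k :: int ^ 'n. k \<noteq> 0 \<Longrightarrow> 2 ^ J k \<le> freq_norm k \<and> freq_norm k < 2 ^ Suc (J k)"
    using dyadic_interval[OF freq_norm_ge_1] by metis
  \<comment> \<open>The terms are nonnegative, so a bound uniform over finite sets of frequencies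
    bounds the whole series. A finite set meets finitely many shells, whose bounds are then extended
    to the full geometric series.\<close>
  have finite_sum: "sum a F \<le> K / (1 - q)" if "finite F" "F \<subseteq> - {0}" for F
  proof -
    have coeff: "fourier_coeff (signed_diff \<mu> torus_lebesgue) k = integral\<^sup>L \<mu> (torus_char k)"
      if "k \<in> F" for k
      using \<open>F \<subseteq> - {0}\<close> \<open>k \<in> F\<close> assms
      by (intro fourier_coeff_signed_diff finite_measure_axioms) auto
    have shell: "2 ^ J k \<le> freq_norm k \<and> freq_norm k < 2 ^ Suc (J k)" if "k \<in> F" for k
      using J[of k] \<open>F \<subseteq> - {0}\<close> \<open>k \<in> F\<close> by blast
    have "sum a F = (\<Sum>j\<in>J ` F. sum a {k \<in> F. J k = j})"
      by (rule sum.image_gen[OF \<open>finite F\<close>])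
    also have "\<dots> \<le> (\<Sum>j\<in>J ` F. K * q ^ j)"
    proof (rule sum_mono)
      fix j
      have "sum a {k \<in> F. J k = j} = (\<Sum>k\<in>{k \<in> F. J k = j}.
          freq_norm k powr (2 * - \<gamma>) * (norm (integral\<^sup>L \<mu> (torus_char k)))\<^sup>2)"
        by (simp add: a_def coeff)
      \<comment> \<open>The block estimate asks for \<open>0 \<le> \<gamma>\<close>, which follows
        from \<open>\<alpha> \<le> real CARD('n)\<close> and the lower bound on
        \<open>\<gamma>\<close>.\<close>
      also have "\<dots> \<le> K * q ^ j"
        unfolding K_def q_def
        using assms \<open>finite F\<close> shell by (intro dyadic_block_le) auto
      finally show "sum a {k \<in> F. J k = j} \<le> K * q ^ j" .
    qed
    also have "\<dots> \<le> (\<Sum>j. K * q ^ j)"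
      using that q \<open>0 \<le> K\<close> by (intro sum_le_suminf summable_mult summable_geometric) auto
    also have "\<dots> = K / (1 - q)"
      using q by (simp add: suminf_mult suminf_geometric summable_geometric)
    finally show ?thesis .
  qed
  have "hdot_norm_sq (- \<gamma>) (signed_diff \<mu> torus_lebesgue) = (\<Sum>\<^sub>\<infinity>k\<in>- {0}. ennreal (a k))"
    by (simp add: hdot_norm_sq_def a_def)
  also have "\<dots> \<le> ennreal (K / (1 - q))"
  proof (rule infsum_le_finite_sums)
    show "(\<lambda>k. ennreal (a k)) summable_on - {0}"
      by (rule nonneg_summable_on_complete) simp
    show "(\<Sum>k\<in>F. ennreal (a k)) \<le> ennreal (K / (1 - q))" if "finite F" "F \<subseteq> - {0}" for F
      using finite_sum[OF that] by (subst sum_ennreal) (auto simp: a_def intro: ennreal_leI)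
  qed
  finally show ?thesis by (simp add: K_def q_def)
qed

theorem proposition4p4:
  fixes \<alpha> \<gamma> :: real
  assumes "0 \<le> \<alpha>" and "\<alpha> \<le> real CARD('n::finite)"
    and "\<gamma> > (real CARD('n) - \<alpha>) / 2"
  shows "\<exists>C>0. \<forall>M>0. \<forall>\<mu> :: ('n torus) measure.
    prob_space \<mu> \<and> sets \<mu> = sets borel \<and> upper_ahlfors_regular \<alpha> M \<mu> \<longrightarrow>
      signed_diff \<mu> torus_lebesgue \<in> hdot (- \<gamma>) \<and>
      hdot_norm_sq (- \<gamma>) (signed_diff \<mu> torus_lebesgue) \<le> ennreal (C * (M + 1))"
proof -
  \<comment> \<open>The denominator comes from summing the geometric series. This \<open>C\<close>
    is built from the dimension, \<open>\<alpha>\<close> and \<open>\<gamma>\<close>, and is chosen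
    before \<open>M\<close> and \<open>\<mu>\<close>.\<close>
  define C where "C = 4 * (64 * real CARD('n)) ^ CARD('n) / (1 - 2 powr (real CARD('n) - \<alpha> - 2 * \<gamma>))"
  have "2 powr (real CARD('n) - \<alpha> - 2 * \<gamma>) < 1"
    using assms by (simp add: powr_less_one)
  then have "0 < C" by (simp add: C_def)
  show ?thesis
  proof (intro exI[of _ C] conjI \<open>0 < C\<close> allI impI)
    fix M :: real and \<mu> :: "('n torus) measure"
    assume "0 < M" and \<mu>: "prob_space \<mu> \<and> sets \<mu> = sets borel \<and> upper_ahlfors_regular \<alpha> M \<mu>"
    then have "hdot_norm_sq (- \<gamma>) (signed_diff \<mu> torus_lebesgue) \<le> ennreal (C * M)"
      unfolding C_def using assms by (intro hdot_norm_sq_ahlfors_le) auto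
    also have "\<dots> \<le> ennreal (C * (M + 1))"
      using \<open>0 < C\<close> by (intro ennreal_leI) simp
    finally show le: "hdot_norm_sq (- \<gamma>) (signed_diff \<mu> torus_lebesgue) \<le> ennreal (C * (M + 1))" .
    interpret M: prob_space \<mu> using \<mu> by blast
    interpret L: prob_space "torus_lebesgue :: ('n torus) measure" by (rule prob_space_torus_lebesgue)
    have "space \<mu> = UNIV" using \<mu> sets_eq_imp_space_eq[of \<mu> borel] by simp
    then have "signed_diff \<mu> torus_lebesgue UNIV = 0"
      using M.prob_space L.prob_space by (simp add: signed_diff_def)
    moreover have "finite_signed_measure (signed_diff \<mu> torus_lebesgue)"
      using \<mu> by (intro finite_signed_measure_signed_diff M.finite_measure_axioms L.finite_measure_axioms)
        (auto simp: sets_torus_lebesgue)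
    ultimately show "signed_diff \<mu> torus_lebesgue \<in> hdot (- \<gamma>)"
      using le by (auto simp: hdot_def intro: le_less_trans)
  qed
qed

end
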